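(* Let $m,n,k\in\mathbb{N}=\{0,1,2,\ldots\}$ and $\xi=m\alpha_1+n\alpha_2+k\alpha_3$. Throughout, for an integer $i$ put $t=m+n+k-i$. \begin{enumerate} \item If $m\geq n$ and $k\geq n$, then $\wp_q(\xi)=\sum_{i=m+k-n}^{m+n+k}(L+1)(L+(t\bmod 2)+1)q^i$, where $L=\min\{\lfloor t/2\rfloor,\ n-\lceil t/2\rceil\}$. \item If $m\geq n\geq k$, then $\wp_q(\xi)=\sum_{i=m}^{m+n+k}c_iq^i$, where \[c_i=\begin{cases}\frac{(L+1)(2k-2F_2+L+2)}{2} & \text{if } J<0,\\[2pt] \frac{(L+1)(L+2)-F_2(F_2+1)-k(k-1)}{2}+F_2k+kL-F_2L+(k-F_2)(t\bmod 2) & \text{if } 0\leq J\leq L,\\[2pt] (L+1)(L+(t\bmod 2)+1) & \text{if } J>L,\end{cases}\] with $F_2=\min\{\lfloor t/2\rfloor,k\}$, $J=k-F_2-(t\bmod 2)$, $F_1=\max\{t-n,0\}$, $L=F_2-F_1$. \item If $k\geq n\geq m$, then $\wp_q(\xi)=\sum_{i=k}^{m+n+k}c_iq^i$, where \[c_i=\begin{cases}\frac{(L+1)(2m-2F_2+L+2)}{2} & \text{if } J<0,\\[2pt] \frac{(L+1)(L+2)-F_2(F_2+1)-m(m-1)}{2}+F_2m+mL-F_2L+(m-F_2)(t\bmod 2) & \text{if } 0\leq J\leq L,\\[2pt] (L+1)(L+(t\bmod 2)+1) & \text{if } J>L,\end{cases}\] with $F_2=\min\{\lfloor t/2\rfloor,m\}$,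 $J=m-F_2-(t\bmod 2)$, $F_1=\max\{t-n,0\}$, $L=F_2-F_1$. \item If $n\geq m\geq k$, then $\wp_q(\xi)=\sum_{i=n}^{m+n+k}c_iq^i$, where $c_i=S_1-S_2+F_2-F_1+1$ with \[S_1=\begin{cases}(t-F_2)(F_2+1) & \text{if } t-m<0,\\ \frac{(t-m)(t-m+1)+F_1(F_1-1)-2F_2(F_2+1)+2m(t-m-F_1+1)+2t(F_2-t+m)}{2} & \text{if } 0\leq t-m\leq F_2,\end{cases}\] \[S_2=\begin{cases}(t-k)(t-k-F_1+1)-\frac{(t-k)(t-k+1)-F_1(F_1-1)}{2} & \text{if } 0\leq t-k\leq F_2,\\ (t-k)(F_2-F_1+1)-\frac{F_2(F_2+1)-F_1(F_1-1)}{2} & \text{if } t-k>F_2,\\ 0 & \text{if } t-k<0,\end{cases}\] and $F_1=\max\{0,t-\min\{m+k,n\}\}$, $F_2=\min\{\lfloor t/2\rfloor,k\}$. \item If $n\geq k\geq m$, then $\wp_q(\xi)=\sum_{i=n}^{m+n+k}c_iq^i$, where $c_i=S_1-S_2+F_2-F_1+1$ with \[S_1=\begin{cases}(t-F_2)(F_2+1) & \text{if } t-k<0,\\ \frac{(t-k)(t-k+1)+F_1(F_1-1)-2F_2(F_2+1)+2k(t-k-F_1+1)+2t(F_2-t+k)}{2} & \text{if } 0\leq t-k\leq F_2,\end{cases}\] \[S_2=\begin{cases}(t-m)(t-m-F_1+1)-\frac{(t-m)(t-m+1)-F_1(F_1-1)}{2} & \text{if } 0\leq t-m\leq F_2,\\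 (t-m)(F_2-F_1+1)-\frac{F_2(F_2+1)-F_1(F_1-1)}{2} & \text{if } t-m>F_2,\\ 0 & \text{if } t-m<0,\end{cases}\] and $F_1=\max\{0,t-\min\{m+k,n\}\}$, $F_2=\min\{\lfloor t/2\rfloor,m\}$. \end{enumerate}
   Context: This concerns the Lie algebra $\mathfrak{sl}_4(\mathbb{C})$ with simple roots $\alpha_1,\alpha_2,\alpha_3$ (linearly independent; $\alpha_i=e_i-e_{i+1}$ in $\mathbb{R}^4$) and positive roots $\Phi^+=\{\alpha_1,\alpha_2,\alpha_3,\alpha_1+\alpha_2,\alpha_2+\alpha_3,\alpha_1+\alpha_2+\alpha_3\}$. For a vector $\xi$ in the real span of the simple roots, the $q$-analog of Kostant's partition function is the polynomial $\wp_q(\xi)=\sum_{i\geq 0}c_iq^i$, where $c_i$ is the number of ways to write $\xi$ as a sum of exactly $i$ positive roots, i.e. the number of tuples $(a_\beta)_{\beta\in\Phi^+}\in\mathbb{N}^6$ with $\sum_\beta a_\beta\beta=\xi$ and $\sum_\beta a_\beta=i$. $\lfloor\cdot\rfloor,\lceil\cdot\rceil$ are floor and ceiling, and $t\bmod 2\in\{0,1\}$. *)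

theory Defs
  imports "HOL-Analysis.Analysis" "HOL-Computational_Algebra.Polynomial"
begin

definition \<alpha>1 :: "real^4" where "\<alpha>1 = axis 1 1 - axis 2 1"
definition \<alpha>2 :: "real^4" where "\<alpha>2 = axis 2 1 - axis 3 1"
definition \<alpha>3 :: "real^4" where "\<alpha>3 = axis 3 1 - axis 4 1"

definition positive_roots :: "(real^4) set" where
  "positive_roots = {\<alpha>1, \<alpha>2, \<alpha>3, \<alpha>1 + \<alpha>2, \<alpha>2 + \<alpha>3, \<alpha>1 + \<alpha>2 + \<alpha>3}"

definition decompositions :: "real^4 \<Rightarrow> nat \<Rightarrow> (real^4 \<Rightarrow> nat) set" where
  "decompositions \<xi> i = {a \<in> positive_roots \<rightarrow>\<^sub>E UNIV.
     (\<Sum>\<beta>\<in>positive_roots. real (a \<beta>) *\<^sub>R \<beta>) = \<xi> \<and> (\<Sum>\<beta>\<in>positive_roots. a \<beta>) = i}"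

(* The coefficients are natural numbers; they are taken in the rationals because the closed
   formulas contain halves.  That the coefficient sequence does have finite support, so that
   Abs_poly is applied to a legitimate argument, is coeff_kostant_q below. *)
definition kostant_q :: "real^4 \<Rightarrow> rat poly" where
  "kostant_q \<xi> = Abs_poly (\<lambda>i. of_nat (card (decompositions \<xi> i)))"

lemma card_positive_roots: "card positive_roots = 6"
proof -
  have "distinct [\<alpha>1, \<alpha>2, \<alpha>3, \<alpha>1 + \<alpha>2, \<alpha>2 + \<alpha>3, \<alpha>1 + \<alpha>2 + \<alpha>3]"
    by (simp add: vec_eq_iff forall_4 \<alpha>1_def \<alpha>2_def \<alpha>3_def axis_def)
  from distinct_card[OF this] show ?thesis
    by (simp add: positive_roots_def)
qed

lemma finite_positive_roots: "finite positive_roots"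
  by (simp add: positive_roots_def)

lemma size_decomposition_le:
  assumes "a \<in> decompositions \<xi> i"
  shows "real i \<le> 3 * \<xi>$1 + 2 * \<xi>$2 + \<xi>$3"
proof -
  have ge1: "1 \<le> 3 * \<beta>$1 + 2 * \<beta>$2 + \<beta>$3" if "\<beta> \<in> positive_roots" for \<beta>
    using that by (auto simp: positive_roots_def \<alpha>1_def \<alpha>2_def \<alpha>3_def axis_def)
  have "real i = (\<Sum>\<beta>\<in>positive_roots. real (a \<beta>) * 1)"
    using assms by (auto simp: decompositions_def)
  also have "\<dots> \<le> (\<Sum>\<beta>\<in>positive_roots. real (a \<beta>) * (3 * \<beta>$1 + 2 * \<beta>$2 + \<beta>$3))"
    by (intro sum_mono mult_left_mono ge1) auto
  also have "\<dots> = 3 * \<xi>$1 + 2 * \<xi>$2 + \<xi>$3"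
    using assms
    by (auto simp: decompositions_def sum_distrib_left sum.distrib[symmetric] algebra_simps)
  finally show ?thesis .
qed

lemma finite_decompositions: "finite (decompositions \<xi> i)"
proof (rule finite_subset)
  show "decompositions \<xi> i \<subseteq> positive_roots \<rightarrow>\<^sub>E {..i}"
  proof
    fix a assume a: "a \<in> decompositions \<xi> i"
    have "a \<beta> \<le> i" if "\<beta> \<in> positive_roots" for \<beta>
      using a member_le_sum[OF that _ finite_positive_roots, of a]
      by (simp add: decompositions_def)
    with a show "a \<in> positive_roots \<rightarrow>\<^sub>E {..i}"
      by (simp add: decompositions_def PiE_iff)
  qed
  show "finite (positive_roots \<rightarrow>\<^sub>E {..i})"
    by (intro finite_PiE finite_positive_roots) auto
qed

lemma coeff_kostant_q: "coeff (kostant_q \<xi>) i = of_nat (card (decompositions \<xi> i))"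
proof -
  let ?N = "nat \<lfloor>3 * \<xi>$1 + 2 * \<xi>$2 + \<xi>$3\<rfloor>"
  have "decompositions \<xi> j = {}" if "j > ?N" for j
  proof (rule ccontr)
    assume "decompositions \<xi> j \<noteq> {}"
    then have "real j \<le> 3 * \<xi>$1 + 2 * \<xi>$2 + \<xi>$3"
      using size_decomposition_le by blast
    with that show False by linarith
  qed
  then show ?thesis
    unfolding kostant_q_def by (subst coeff_Abs_poly[of ?N]) auto
qed

(* In the coefficient formulas t stands for m + n + k - i.  The last two assume k <= m; the
   formulas for m <= k arise from them by exchanging m and k throughout. *)

definition coeff_n_smallest :: "int \<Rightarrow> int \<Rightarrow> rat" where
  "coeff_n_smallest n t =
    (let L = min \<lfloor>of_int t / (2::rat)\<rfloor> (n - \<lceil>of_int t / (2::rat)\<rceil>)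
     in of_int ((L + 1) * (L + t mod 2 + 1)))"

(* For k <= n <= m; m enters only through t. *)
definition coeff_n_middle :: "int \<Rightarrow> int \<Rightarrow> int \<Rightarrow> rat" where
  "coeff_n_middle n k t =
    (let F2 = min \<lfloor>of_int t / (2::rat)\<rfloor> k;
         J = k - F2 - t mod 2;
         F1 = max (t - n) 0;
         L = F2 - F1
     in if J < 0 then of_int ((L + 1) * (2 * k - 2 * F2 + L + 2)) / 2
        else if J \<le> L then
          of_int ((L + 1) * (L + 2) - F2 * (F2 + 1) - k * (k - 1)) / 2
          + of_int (F2 * k + k * L - F2 * L + (k - F2) * (t mod 2))
        else of_int ((L + 1) * (L + t mod 2 + 1)))"

(* For k <= m <= n.  S1 is given no value for
   t - m > F2: this does not occur for 0 <= t <= m + k, the only range in which the formula is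
   used. *)
definition coeff_n_largest :: "int \<Rightarrow> int \<Rightarrow> int \<Rightarrow> int \<Rightarrow> rat" where
  "coeff_n_largest m n k t =
    (let F1 = max 0 (t - min (m + k) n);
         F2 = min \<lfloor>of_int t / (2::rat)\<rfloor> k;
         S1 = (if t - m < 0 then of_int ((t - F2) * (F2 + 1))
               else if t - m \<le> F2 then
                 of_int ((t - m) * (t - m + 1) + F1 * (F1 - 1) - 2 * F2 * (F2 + 1)
                         + 2 * m * (t - m - F1 + 1) + 2 * t * (F2 - t + m)) / 2
               else undefined);
         S2 = (if t - k < 0 then 0
               else if t - k \<le> F2 then
                 of_int ((t - k) * (t - k - F1 + 1))
                 - of_int ((t - k) * (t - k + 1) - F1 * (F1 - 1)) / 2
               else
                 of_int ((t - k) * (F2 - F1 + 1))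
                 - of_int (F2 * (F2 + 1) - F1 * (F1 - 1)) / 2)
     in S1 - S2 + of_int (F2 - F1 + 1))"

lemma coeff_n_largest_cases_exhaustive:
  fixes m k t :: int
  assumes "0 \<le> k" "k \<le> m" "t \<le> m + k"
  shows "t - m \<le> min \<lfloor>of_int t / (2::rat)\<rfloor> k"
proof -
  have "\<lfloor>of_int t / (2::rat)\<rfloor> = t div 2"
    using floor_divide_of_int_eq[of t 2, where ?'a = rat] by simp
  with assms show ?thesis by simp
qed

end

theory Submission
  imports Defs
begin

text \<open>
  Let \<open>f\<close> and \<open>j\<close> be the multiplicities of \<open>\<alpha>1 + \<alpha>2 + \<alpha>3\<close> and \<open>\<alpha>1 + \<alpha>2\<close> in a decomposition of
  \<open>m \<alpha>1 + n \<alpha>2 + k \<alpha>3\<close> into \<open>i\<close> positive roots.  With \<open>t = m + n + k - i\<close> all other multiplicities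
  are determined: \<open>\<alpha>2 + \<alpha>3\<close> occurs \<open>t - 2 f - j\<close> times and the simple roots fill up the rest.
  For fixed \<open>f \<ge> t - n\<close>, the values of \<open>j\<close> form an interval with
  \<open>min (m + k - t) (m - f) (k - f) (t - 2 f) + 1\<close> elements (none if this is negative), so every coefficient is a sum over an interval of
  a piecewise linear function of \<open>f\<close>.  The ordering of \<open>m\<close>, \<open>n\<close>, \<open>k\<close> decides which pieces occur.
\<close>

text \<open>The bounds on \<open>f\<close> say that \<open>\<alpha>2\<close> has multiplicity
  \<open>n - t + f \<ge> 0\<close> and that \<open>t - 2 * f \<ge> 0\<close>. The four terms of the
  minimum are the differences between the upper bounds \<open>m - f\<close>,
  \<open>t - 2 * f\<close> and the lower bounds \<open>0\<close>, \<open>t - f - k\<close> of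
  \<open>j\<close>.\<close>

definition kostant_count :: "int \<Rightarrow> int \<Rightarrow> int \<Rightarrow> int \<Rightarrow> int" where
  "kostant_count m n k t = (\<Sum>f = max 0 (t - n)..t div 2.
     max 0 (min (min (m + k - t) (m - f)) (min (k - f) (t - 2 * f)) + 1))"

text \<open>This is the diagram symmetry exchanging \<open>\<alpha>1\<close> and
  \<open>\<alpha>3\<close>; it yields the orderings with \<open>m\<close> and \<open>k\<close>
  swapped.\<close>

lemma kostant_count_commute: "kostant_count m n k t = kostant_count k n m t"
  unfolding kostant_count_def by (intro sum.cong refl) (simp add: ac_simps)

section \<open>Decompositions as lattice points\<close>

lemma distinct_positive_roots:
  "distinct [\<alpha>1, \<alpha>2, \<alpha>3, \<alpha>1 + \<alpha>2, \<alpha>2 + \<alpha>3, \<alpha>1 + \<alpha>2 + \<alpha>3]"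
  "distinct [\<alpha>1 + \<alpha>2 + \<alpha>3, \<alpha>2 + \<alpha>3, \<alpha>1 + \<alpha>2, \<alpha>3, \<alpha>2, \<alpha>1]"
  by (simp_all add: vec_eq_iff forall_4 \<alpha>1_def \<alpha>2_def \<alpha>3_def axis_def)

lemma sum_positive_roots:
  "sum g positive_roots = g \<alpha>1 + g \<alpha>2 + g \<alpha>3 + g (\<alpha>1 + \<alpha>2) + g (\<alpha>2 + \<alpha>3) + g (\<alpha>1 + \<alpha>2 + \<alpha>3)"
  for g :: "real^4 \<Rightarrow> 'a::comm_monoid_add"
proof -
  have "sum g positive_roots = sum_list (map g [\<alpha>1, \<alpha>2, \<alpha>3, \<alpha>1 + \<alpha>2, \<alpha>2 + \<alpha>3, \<alpha>1 + \<alpha>2 + \<alpha>3])"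
    using distinct_positive_roots by (subst sum_list_distinct_conv_sum_set) (simp_all only: positive_roots_def list.set)
  then show ?thesis by (simp add: add.assoc)
qed

lemma simple_root_combination_eq_iff:
  "x *\<^sub>R \<alpha>1 + y *\<^sub>R \<alpha>2 + z *\<^sub>R \<alpha>3 = x' *\<^sub>R \<alpha>1 + y' *\<^sub>R \<alpha>2 + z' *\<^sub>R \<alpha>3 \<longleftrightarrow> x = x' \<and> y = y' \<and> z = z'"
  by (auto simp: vec_eq_iff forall_4 \<alpha>1_def \<alpha>2_def \<alpha>3_def axis_def)

text \<open>Linear independence of the simple roots splits the vector equation into one equation per
  simple root.\<close>

lemma decompositions_iff:
  "a \<in> decompositions (real m *\<^sub>R \<alpha>1 + real n *\<^sub>R \<alpha>2 + real k *\<^sub>R \<alpha>3) i \<longleftrightarrow>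
     a \<in> positive_roots \<rightarrow>\<^sub>E UNIV \<and>
     a \<alpha>1 + a (\<alpha>1 + \<alpha>2) + a (\<alpha>1 + \<alpha>2 + \<alpha>3) = m \<and>
     a \<alpha>2 + a (\<alpha>1 + \<alpha>2) + a (\<alpha>2 + \<alpha>3) + a (\<alpha>1 + \<alpha>2 + \<alpha>3) = n \<and>
     a \<alpha>3 + a (\<alpha>2 + \<alpha>3) + a (\<alpha>1 + \<alpha>2 + \<alpha>3) = k \<and>
     a \<alpha>1 + a \<alpha>2 + a \<alpha>3 + a (\<alpha>1 + \<alpha>2) + a (\<alpha>2 + \<alpha>3) + a (\<alpha>1 + \<alpha>2 + \<alpha>3) = i"
proof -
  have "(\<Sum>\<beta>\<in>positive_roots. real (a \<beta>) *\<^sub>R \<beta>) =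
      real (a \<alpha>1 + a (\<alpha>1 + \<alpha>2) + a (\<alpha>1 + \<alpha>2 + \<alpha>3)) *\<^sub>R \<alpha>1 +
      real (a \<alpha>2 + a (\<alpha>1 + \<alpha>2) + a (\<alpha>2 + \<alpha>3) + a (\<alpha>1 + \<alpha>2 + \<alpha>3)) *\<^sub>R \<alpha>2 +
      real (a \<alpha>3 + a (\<alpha>2 + \<alpha>3) + a (\<alpha>1 + \<alpha>2 + \<alpha>3)) *\<^sub>R \<alpha>3"
    by (simp add: sum_positive_roots algebra_simps)
  then show ?thesis
    by (simp only: decompositions_def mem_Collect_eq simple_root_combination_eq_iff
        sum_positive_roots of_nat_eq_iff conj_assoc)
qed

lemma card_decompositions:
  fixes m n k i :: nat
  defines "t \<equiv> int m + int n + int k - int i"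
  shows "int (card (decompositions (real m *\<^sub>R \<alpha>1 + real n *\<^sub>R \<alpha>2 + real k *\<^sub>R \<alpha>3) i)) =
    kostant_count (int m) (int n) (int k) t"
proof -
  let ?D = "decompositions (real m *\<^sub>R \<alpha>1 + real n *\<^sub>R \<alpha>2 + real k *\<^sub>R \<alpha>3) i"
  let ?I = "{max 0 (t - n)..t div 2}"
  let ?J = "\<lambda>f::int. {max 0 (t - f - k)..min (m - f) (t - 2 * f)}"
  let ?h = "\<lambda>a::real^4 \<Rightarrow> nat. (int (a (\<alpha>1 + \<alpha>2 + \<alpha>3)), int (a (\<alpha>1 + \<alpha>2)))"
  \<comment> \<open>The inverse of \<open>?h\<close>: subtracting the size equation from the sum of
    the other three gives \<open>t = a (\<alpha>1 + \<alpha>2) + a (\<alpha>2 + \<alpha>3) + 2 * a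
    (\<alpha>1 + \<alpha>2 + \<alpha>3)\<close>, which fixes the multiplicity of
    \<open>\<alpha>2 + \<alpha>3\<close>; the equations for \<open>m\<close>, \<open>n\<close>,
    \<open>k\<close> then give the simple roots.\<close>
  define g where "g = (\<lambda>(f::int, j::int). restrict (\<lambda>\<beta>. nat (
      if \<beta> = \<alpha>1 then m - f - j else if \<beta> = \<alpha>2 then n - t + f else
      if \<beta> = \<alpha>3 then k - (t - f - j) else if \<beta> = \<alpha>1 + \<alpha>2 then j else
      if \<beta> = \<alpha>2 + \<alpha>3 then t - 2 * f - j else f)) positive_roots)"
  have roots: "\<alpha>1 \<in> positive_roots" "\<alpha>2 \<in> positive_roots" "\<alpha>3 \<in> positive_roots"
    "\<alpha>1 + \<alpha>2 \<in> positive_roots" "\<alpha>2 + \<alpha>3 \<in> positive_roots" "\<alpha>1 + \<alpha>2 + \<alpha>3 \<in> positive_roots"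
    by (simp_all add: positive_roots_def)
  have g_root: "g (f, j) \<alpha>1 = nat (m - f - j)" "g (f, j) \<alpha>2 = nat (n - t + f)"
    "g (f, j) \<alpha>3 = nat (k - (t - f - j))" "g (f, j) (\<alpha>1 + \<alpha>2) = nat j"
    "g (f, j) (\<alpha>2 + \<alpha>3) = nat (t - 2 * f - j)" "g (f, j) (\<alpha>1 + \<alpha>2 + \<alpha>3) = nat f" for f j :: int
    unfolding g_def using distinct_positive_roots roots by simp_all
  have "bij_betw ?h ?D (Sigma ?I ?J)"
  proof (rule bij_betw_byWitness[where f' = g])
    show "\<forall>a\<in>?D. g (?h a) = a"
    proof
      fix a assume "a \<in> ?D"
      then have a: "a \<in> extensional positive_roots"
        and eqs: "a \<alpha>1 + a (\<alpha>1 + \<alpha>2) + a (\<alpha>1 + \<alpha>2 + \<alpha>3) = m"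
          "a \<alpha>2 + a (\<alpha>1 + \<alpha>2) + a (\<alpha>2 + \<alpha>3) + a (\<alpha>1 + \<alpha>2 + \<alpha>3) = n"
          "a \<alpha>3 + a (\<alpha>2 + \<alpha>3) + a (\<alpha>1 + \<alpha>2 + \<alpha>3) = k"
          "a \<alpha>1 + a \<alpha>2 + a \<alpha>3 + a (\<alpha>1 + \<alpha>2) + a (\<alpha>2 + \<alpha>3) + a (\<alpha>1 + \<alpha>2 + \<alpha>3) = i"
        unfolding decompositions_iff PiE_iff by blast+
      show "g (?h a) = a"
      proof (rule extensionalityI[OF _ a])
        show "g (?h a) \<in> extensional positive_roots" by (simp add: g_def)
        fix \<beta> assume "\<beta> \<in> positive_roots"
        then consider "\<beta> = \<alpha>1" | "\<beta> = \<alpha>2" | "\<beta> = \<alpha>3" | "\<beta> = \<alpha>1 + \<alpha>2" | "\<beta> = \<alpha>2 + \<alpha>3"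
          | "\<beta> = \<alpha>1 + \<alpha>2 + \<alpha>3"
          unfolding positive_roots_def by blast
        then show "g (?h a) \<beta> = a \<beta>"
          using eqs by cases (simp_all only: g_root, auto simp: t_def)
      qed
    qed
    have hg: "?h (g (f, j)) = (f, j)" if "f \<in> ?I" "j \<in> ?J f" for f j
      using that unfolding g_root by simp
    show "\<forall>p\<in>Sigma ?I ?J. ?h (g p) = p"
    proof
      fix p assume "p \<in> Sigma ?I ?J"
      then obtain f j where "p = (f, j)" "f \<in> ?I" "j \<in> ?J f" by (rule SigmaE)
      then show "?h (g p) = p" using hg[of f j] by (simp only:)
    qed
    show "?h ` ?D \<subseteq> Sigma ?I ?J"
    proof (rule image_subsetI)
      fix a assume "a \<in> ?D"
      then show "?h a \<in> Sigma ?I ?J"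
        unfolding decompositions_iff by (auto simp: t_def)
    qed
    have g_mem: "g (f, j) \<in> ?D" if "f \<in> ?I" "j \<in> ?J f" for f j
    proof -
      \<comment> \<open>One inequality for each of the six multiplicities, so \<open>nat\<close>
        truncates none of them.\<close>
      have "0 \<le> f" "0 \<le> j" "t - n \<le> f" "t - f - k \<le> j" "j \<le> m - f" "j \<le> t - 2 * f"
        using that by auto
      moreover have "g (f, j) \<in> positive_roots \<rightarrow>\<^sub>E UNIV" by (simp add: g_def)
      ultimately show ?thesis
        unfolding decompositions_iff g_root int_int_eq[symmetric] of_nat_add by (simp add: t_def)
    qed
    show "g ` Sigma ?I ?J \<subseteq> ?D"
    proof (rule image_subsetI)
      fix p assume "p \<in> Sigma ?I ?J"
      then obtain f j where "p = (f, j)" "f \<in> ?I" "j \<in> ?J f" by (rule SigmaE)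
      then show "g p \<in> ?D" using g_mem[of f j] by (simp only:)
    qed
  qed
  then have "card ?D = card (Sigma ?I ?J)" by (rule bij_betw_same_card)
  also have "\<dots> = (\<Sum>f\<in>?I. card (?J f))" by (rule card_SigmaI) auto
  also have "int \<dots> = kostant_count m n k t"
    unfolding kostant_count_def of_nat_sum by (intro sum.cong refl) auto
  finally show ?thesis .
qed

text \<open>The first two conditions empty the range of \<open>f\<close>; the last two make
  \<open>m + k - t\<close> or \<open>k - f\<close> negative in every term. In terms of
  \<open>i\<close> they read \<open>i > m + n + k\<close>, \<open>i < m + k - n\<close>,
  \<open>i < n\<close> and \<open>i < m\<close>.\<close>

lemma kostant_count_eq_0:
  assumes "t < 0 \<or> t > 2 * n \<or> t > m + k \<or> t > n + k"
  shows "kostant_count m n k t = 0"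
  unfolding kostant_count_def
  using assms by (intro sum.neutral) auto

section \<open>Sums over integer intervals\<close>

text \<open>The arithmetic series, doubled to stay in the integers. The bound
  \<open>a \<le> b + 1\<close> admits the empty interval, which occurs when a break point of a
  piecewise sum lies at its upper end.\<close>

lemma double_sum_affine:
  fixes a b c d :: int
  assumes "a \<le> b + 1"
  shows "2 * (\<Sum>f = a..b. c + d * f) = (2 * c + d * (a + b)) * (b - a + 1)"
proof -
  have "2 * (\<Sum>f = a..a - 1 + int l. c + d * f) = (2 * c + d * (2 * a - 1 + int l)) * int l" for l
  proof (induction l)
    case (Suc l)
    have "{a..a - 1 + int (Suc l)} = insert (a + int l) {a..a - 1 + int l}" by auto
    then show ?case using Suc by (simp add: algebra_simps)
  qed simp
  from this[of "nat (b - a + 1)"] assms show ?thesis by simp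
qed

lemma sum_split_int:
  fixes a b s :: int and g :: "int \<Rightarrow> 'a::comm_monoid_add"
  assumes "a \<le> s + 1" "s \<le> b"
  shows "sum g {a..b} = sum g {a..s} + sum g {s + 1..b}"
proof -
  have "{a..b} = {a..s} \<union> {s + 1..b}" using assms by auto
  then show ?thesis by (simp add: sum.union_disjoint)
qed

section \<open>Closed forms of the coefficients\<close>

lemma floor_half: "\<lfloor>of_int t / (2::rat)\<rfloor> = t div 2"
  using floor_divide_of_int_eq[of t 2, where ?'a = rat] by simp

lemma ceiling_half: "\<lceil>of_int t / (2::rat)\<rceil> = t div 2 + t mod 2"
  using floor_half[of "- t"] unfolding ceiling_def by (simp, presburger)

text \<open>From \<open>f \<ge> t - n\<close> follows \<open>t - f \<le> n\<close>, which is at most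
  \<open>m\<close> and \<open>k\<close>; hence \<open>t - 2 * f\<close> is always the least of the
  four terms and the sum is a single arithmetic series.\<close>

lemma coeff_n_smallest:
  assumes "n \<le> m" "n \<le> k" "0 \<le> t" "t \<le> 2 * n"
  shows "of_int (kostant_count m n k t) = coeff_n_smallest n t"
proof -
  define h r where "h = t div 2" and "r = t mod 2"
  have t: "t = 2 * h + r" and r: "r = 0 \<or> r = 1" by (auto simp: h_def r_def)
  define L where "L = min h (n - (h + r))"
  \<comment> \<open>So \<open>f\<close> takes exactly \<open>L + 1\<close> values.\<close>
  have F1: "max 0 (t - n) = h - L" by (auto simp: L_def t)
  then have F: "0 \<le> h - L" "t - n \<le> h - L" by linarith+
  have "kostant_count m n k t = (\<Sum>f = h - L..h. (t + 1) + (-2) * f)"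
    unfolding kostant_count_def F1 h_def[symmetric]
    using assms F r by (intro sum.cong refl) (auto simp: t)
  also have "2 * \<dots> = 2 * ((L + 1) * (L + r + 1))"
    using assms r by (subst double_sum_affine) (auto simp: L_def t algebra_simps)
  finally have "kostant_count m n k t = (L + 1) * (L + r + 1)" by simp
  then show ?thesis
    by (simp only: coeff_n_smallest_def floor_half ceiling_half Let_def L_def h_def r_def)
qed

text \<open>Here \<open>t - f \<le> n \<le> m\<close> leaves only \<open>k - f\<close> and
  \<open>t - 2 * f\<close> in the minimum. They cross at \<open>f = t - k\<close>, and the three
  cases reflect where this point lies relative to the range of \<open>f\<close>.\<close>

lemma coeff_n_middle:
  assumes "0 \<le> k" "k \<le> n" "n \<le> m" "0 \<le> t" "t \<le> n + k"
  shows "of_int (kostant_count m n k t) = coeff_n_middle n k t"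
proof -
  define h r where "h = t div 2" and "r = t mod 2"
  have t: "t = 2 * h + r" and r: "r = 0 \<or> r = 1" by (auto simp: h_def r_def)
  define F1 F2 where "F1 = max (t - n) 0" and "F2 = min h k"
  have F: "0 \<le> F1" "F1 \<le> F2" "t - n \<le> F1" "F2 \<le> h" "F2 \<le> k"
    using assms r by (auto simp: F1_def F2_def t)
  define c where "c = (\<lambda>f. min (k - f) (t - 2 * f) + 1)"
  have count: "kostant_count m n k t = (\<Sum>f = F1..F2. c f)"
    unfolding kostant_count_def c_def h_def[symmetric] max.commute[of 0 "t - n"] F1_def[symmetric]
    using assms F r by (intro sum.mono_neutral_cong_right) (auto simp: t F2_def)
  define J L where "J = k - F2 - r" and "L = F2 - F1"
  \<comment> \<open>Doubling clears the halves, so that each case becomes an integer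
    identity.\<close>
  have goal: ?thesis if "2 * kostant_count m n k t =
      (if J < 0 then (L + 1) * (2 * k - 2 * F2 + L + 2)
       else if J \<le> L then (L + 1) * (L + 2) - F2 * (F2 + 1) - k * (k - 1)
          + 2 * (F2 * k + k * L - F2 * L + (k - F2) * r)
       else 2 * ((L + 1) * (L + r + 1)))"
  proof -
    have half: "(of_int (A + 2 * B) :: rat) / 2 = of_int A / 2 + of_int B"
      "(of_int (2 * B) :: rat) / 2 = of_int B" for A B
      by (simp_all add: add_divide_distrib)
    have "(of_int (kostant_count m n k t) :: rat) = of_int (2 * kostant_count m n k t) / 2"
      by simp
    also have "\<dots> = coeff_n_middle n k t"
      unfolding that coeff_n_middle_def floor_half Let_def h_def[symmetric] r_def[symmetric]
        F2_def[symmetric] F1_def[symmetric] J_def[symmetric] L_def[symmetric]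
      by (simp only: half split: if_split) simp
    finally show ?thesis .
  qed
  consider "J < 0 \<or> k < h" | "0 \<le> J" "J \<le> L" "h \<le> k" | "J > L" by linarith
  then show ?thesis
  proof cases
    case 1
    text \<open>If \<open>t\<close> is even and \<open>k < h\<close>, then \<open>J = 0\<close> selects the second formula, but only the
      piece \<open>k - f\<close> occurs in the sum; there the first two formulas agree.\<close>
    then have F2: "F2 = k" and J: "J = - r" using r by (auto simp: J_def F2_def)
    have "(\<Sum>f = F1..F2. c f) = (\<Sum>f = F1..F2. (k + 1) + (-1) * f)"
      using 1 F r F2 J by (intro sum.cong refl) (auto simp: c_def t)
    then have "2 * kostant_count m n k t = (L + 1) * (2 * k - 2 * F2 + L + 2)"
      unfolding count using F double_sum_affine[of F1 F2 "k + 1" "-1"]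
      by (simp add: L_def algebra_simps)
    then show ?thesis using 1 F r by (intro goal) (auto simp: J L_def F2 algebra_simps)
  next
    case 2
    have F2: "F2 = h" using 2 by (simp add: F2_def)
    text \<open>The two affine pieces of \<open>c\<close> meet at \<open>t - k = F2 - J\<close>.\<close>
    have "(\<Sum>f = F1..F2. c f) = (\<Sum>f = F1..t - k. c f) + (\<Sum>f = t - k + 1..F2. c f)"
      using 2 r F2 by (intro sum_split_int) (auto simp: t J_def L_def)
    also have "(\<Sum>f = F1..t - k. c f) = (\<Sum>f = F1..t - k. (k + 1) + (-1) * f)"
      by (intro sum.cong refl) (auto simp: c_def)
    also have "(\<Sum>f = t - k + 1..F2. c f) = (\<Sum>f = t - k + 1..F2. (t + 1) + (-2) * f)"
      by (intro sum.cong refl) (auto simp: c_def)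
    finally have "2 * kostant_count m n k t =
        (2 * (k + 1) + (-1) * (F1 + (t - k))) * (t - k - F1 + 1) +
        (2 * (t + 1) + (-2) * ((t - k + 1) + F2)) * (F2 - (t - k + 1) + 1)"
      unfolding count
      using 2 r F2 double_sum_affine[of F1 "t - k" "k + 1" "-1"]
        double_sum_affine[of "t - k + 1" F2 "t + 1" "-2"] by (simp add: t J_def L_def)
    then show ?thesis using 2 r by (intro goal) (auto simp: L_def t F2 algebra_simps)
  next
    case 3
    \<comment> \<open>Since \<open>J > L \<ge> 0\<close>, \<open>F2\<close> lies below
      \<open>k\<close>. Then \<open>J > L\<close> means \<open>t - k < F1\<close>, so only the piece
      \<open>t - 2 * f\<close> occurs.\<close>
    have F2: "F2 = h" using 3 F r by (auto simp: J_def L_def F2_def)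
    have "(\<Sum>f = F1..F2. c f) = (\<Sum>f = F1..F2. (t + 1) + (-2) * f)"
      using 3 F r F2 by (intro sum.cong refl) (auto simp: c_def t J_def L_def)
    then have "2 * kostant_count m n k t = 2 * ((L + 1) * (L + r + 1))"
      unfolding count using F double_sum_affine[of F1 F2 "t + 1" "-2"]
      by (simp add: L_def F2 t algebra_simps)
    then show ?thesis using 3 F by (intro goal) (auto simp: L_def)
  qed
qed

text \<open>The upper and lower ends of the interval of \<open>j\<close> are summed separately, as
  \<open>S1\<close> and \<open>S2\<close>. Each is piecewise affine with one break, at
  \<open>f = t - m\<close> and \<open>f = t - k\<close> respectively.\<close>

lemma coeff_n_largest:
  assumes "0 \<le> k" "k \<le> m" "m \<le> n" "0 \<le> t" "t \<le> m + k"
  shows "of_int (kostant_count m n k t) = coeff_n_largest m n k t"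
proof -
  define h where "h = t div 2"
  define F1 F2 where "F1 = max 0 (t - min (m + k) n)" and "F2 = min h k"
  have F1: "max 0 (t - n) = F1" using assms by (auto simp: F1_def)
  have F: "0 \<le> F1" "F1 \<le> F2" "F1 \<le> max 0 (t - m)" "F2 \<le> h" "F2 \<le> k" "t - m \<le> F2" "2 * h \<le> t"
    using assms by (auto simp: F1_def F2_def h_def)
  define S1 S2 where "S1 = (\<Sum>f = F1..F2. min m (t - f) - f)"
    and "S2 = (\<Sum>f = F1..F2. max 0 (t - k - f))"
  have "kostant_count m n k t = (\<Sum>f = F1..F2. (min m (t - f) - f) - max 0 (t - k - f) + 1)"
    unfolding kostant_count_def h_def[symmetric] F1
    using assms F by (intro sum.mono_neutral_cong_right) (auto simp: F2_def)
  also have "\<dots> = S1 - S2 + (F2 - F1 + 1)"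
    using F by (simp add: S1_def S2_def sum.distrib sum_subtractf)
  finally have count: "kostant_count m n k t = S1 - S2 + (F2 - F1 + 1)" .
  have S1: "2 * S1 = (if t - m < 0 then 2 * ((t - F2) * (F2 + 1))
      else (t - m) * (t - m + 1) + F1 * (F1 - 1) - 2 * F2 * (F2 + 1)
        + 2 * m * (t - m - F1 + 1) + 2 * t * (F2 - t + m))"
  proof (cases "t - m < 0")
    case True
    \<comment> \<open>This is why \<open>F1\<close> is absent from the first formula for
      \<open>S1\<close>.\<close>
    then have "F1 = 0" using F by simp
    have "S1 = (\<Sum>f = F1..F2. t + (-2) * f)"
      unfolding S1_def using True F by (intro sum.cong refl) auto
    then show ?thesis
      using True F double_sum_affine[of F1 F2 t "-2"] by (simp add: \<open>F1 = 0\<close> algebra_simps)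
  next
    case False
    have "S1 = (\<Sum>f = F1..t - m. min m (t - f) - f) + (\<Sum>f = t - m + 1..F2. min m (t - f) - f)"
      unfolding S1_def using False F by (intro sum_split_int) auto
    also have "(\<Sum>f = F1..t - m. min m (t - f) - f) = (\<Sum>f = F1..t - m. m + (-1) * f)"
      by (intro sum.cong refl) auto
    also have "(\<Sum>f = t - m + 1..F2. min m (t - f) - f) = (\<Sum>f = t - m + 1..F2. t + (-2) * f)"
      by (intro sum.cong refl) auto
    finally have "2 * S1 = (2 * m + (-1) * (F1 + (t - m))) * (t - m - F1 + 1) +
        (2 * t + (-2) * ((t - m + 1) + F2)) * (F2 - (t - m + 1) + 1)"
      using False F double_sum_affine[of F1 "t - m" m "-1"]
        double_sum_affine[of "t - m + 1" F2 t "-2"] by simp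
    then show ?thesis using False by (simp add: algebra_simps)
  qed
  have S2: "2 * S2 = (if t - k < 0 then 0
      else if t - k \<le> F2 then
        2 * ((t - k) * (t - k - F1 + 1)) - ((t - k) * (t - k + 1) - F1 * (F1 - 1))
      else 2 * ((t - k) * (F2 - F1 + 1)) - (F2 * (F2 + 1) - F1 * (F1 - 1)))"
  proof -
    consider "t - k < 0" | "0 \<le> t - k" "t - k \<le> F2" | "t - k > F2" by linarith
    then show ?thesis
    proof cases
      case 1
      then have "S2 = 0" unfolding S2_def using F by (intro sum.neutral) auto
      with 1 show ?thesis by simp
    next
      case 2
      have "S2 = (\<Sum>f = F1..t - k. max 0 (t - k - f)) + (\<Sum>f = t - k + 1..F2. max 0 (t - k - f))"
        unfolding S2_def using 2 F assms by (intro sum_split_int) auto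
      also have "(\<Sum>f = F1..t - k. max 0 (t - k - f)) = (\<Sum>f = F1..t - k. (t - k) + (-1) * f)"
        by (intro sum.cong refl) auto
      also have "(\<Sum>f = t - k + 1..F2. max 0 (t - k - f)) = 0"
        by (intro sum.neutral) auto
      finally have "2 * S2 = (2 * (t - k) + (-1) * (F1 + (t - k))) * (t - k - F1 + 1)"
        using 2 F assms double_sum_affine[of F1 "t - k" "t - k" "-1"] by simp
      then show ?thesis using 2 by (simp add: algebra_simps)
    next
      case 3
      have "S2 = (\<Sum>f = F1..F2. (t - k) + (-1) * f)"
        unfolding S2_def using 3 by (intro sum.cong refl) auto
      then have "2 * S2 = (2 * (t - k) + (-1) * (F1 + F2)) * (F2 - F1 + 1)"
        using F double_sum_affine[of F1 F2 "t - k" "-1"] by simp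
      then show ?thesis using 3 F by (simp add: algebra_simps)
    qed
  qed
  have half: "(of_int S :: rat) = of_int (2 * S) / 2" for S by simp
  \<comment> \<open>\<open>F(6)\<close>, that is \<open>t - m \<le> F2\<close>, excludes the
    \<open>undefined\<close> branch.\<close>
  show ?thesis
    unfolding count coeff_n_largest_def floor_half Let_def h_def[symmetric]
      F1_def[symmetric] F2_def[symmetric] of_int_add of_int_diff half[of S1] half[of S2] S1 S2
    using F(6) by (auto simp: diff_divide_distrib)
qed

section \<open>From coefficients to the polynomial\<close>

lemma kostant_q_eqI:
  fixes m n k :: nat and c :: "int \<Rightarrow> rat"
  assumes out: "\<And>t. t > int m + int n + int k - int l \<Longrightarrow> kostant_count m n k t = 0"
    and coeff: "\<And>t. 0 \<le> t \<Longrightarrow> t \<le> int m + int n + int k - int l \<Longrightarrow>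
      of_int (kostant_count m n k t) = c t"
  shows "kostant_q (real m *\<^sub>R \<alpha>1 + real n *\<^sub>R \<alpha>2 + real k *\<^sub>R \<alpha>3) =
    (\<Sum>i = l..m + n + k. monom (c (int m + int n + int k - int i)) i)"
proof (rule poly_eqI)
  fix i
  let ?t = "int m + int n + int k - int i"
  have "coeff (kostant_q (real m *\<^sub>R \<alpha>1 + real n *\<^sub>R \<alpha>2 + real k *\<^sub>R \<alpha>3)) i =
      of_int (kostant_count m n k ?t)"
    unfolding coeff_kostant_q card_decompositions[symmetric] by simp
  \<comment> \<open>Degrees below \<open>l\<close> are covered by \<open>out\<close>; degrees above
    \<open>m + n + k\<close> have \<open>?t < 0\<close>.\<close>
  also have "\<dots> = (if i \<in> {l..m + n + k} then c ?t else 0)"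
    using out[of ?t] coeff[of ?t] kostant_count_eq_0[of ?t] by auto
  also have "\<dots> = coeff (\<Sum>i = l..m + n + k. monom (c (int m + int n + int k - int i)) i) i"
    by (simp add: coeff_sum)
  finally show "coeff (kostant_q (real m *\<^sub>R \<alpha>1 + real n *\<^sub>R \<alpha>2 + real k *\<^sub>R \<alpha>3)) i =
    coeff (\<Sum>i = l..m + n + k. monom (c (int m + int n + int k - int i)) i) i" .
qed

theorem theorem1:
  fixes m n k :: nat
  shows "let \<xi> = real m *\<^sub>R \<alpha>1 + real n *\<^sub>R \<alpha>2 + real k *\<^sub>R \<alpha>3;
             t = (\<lambda>i::nat. int m + int n + int k - int i)
         in
           (m \<ge> n \<and> k \<ge> n \<longrightarrow>
             kostant_q \<xi> = (\<Sum>i = m + k - n..m + n + k. monom (coeff_n_smallest (int n) (t i)) i)) \<and>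
           (m \<ge> n \<and> n \<ge> k \<longrightarrow>
             kostant_q \<xi> = (\<Sum>i = m..m + n + k. monom (coeff_n_middle (int n) (int k) (t i)) i)) \<and>
           (k \<ge> n \<and> n \<ge> m \<longrightarrow>
             kostant_q \<xi> = (\<Sum>i = k..m + n + k. monom (coeff_n_middle (int n) (int m) (t i)) i)) \<and>
           (n \<ge> m \<and> m \<ge> k \<longrightarrow>
             kostant_q \<xi> = (\<Sum>i = n..m + n + k. monom (coeff_n_largest (int m) (int n) (int k) (t i)) i)) \<and>
           (n \<ge> k \<and> k \<ge> m \<longrightarrow>
             kostant_q \<xi> = (\<Sum>i = n..m + n + k. monom (coeff_n_largest (int k) (int n) (int m) (t i)) i))"
  unfolding Let_def
proof (intro conjI impI; elim conjE)
  \<comment> \<open>As \<open>n \<le> m\<close>, the natural subtraction \<open>m + k - n\<close> is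
    exact and the largest \<open>t\<close> is \<open>2 * n\<close>.\<close>
  assume "n \<le> m" "n \<le> k"
  then show "kostant_q (real m *\<^sub>R \<alpha>1 + real n *\<^sub>R \<alpha>2 + real k *\<^sub>R \<alpha>3) =
    (\<Sum>i = m + k - n..m + n + k. monom (coeff_n_smallest n (int m + int n + int k - int i)) i)"
    by (intro kostant_q_eqI kostant_count_eq_0 coeff_n_smallest) (auto simp: of_nat_diff)
next
  assume "n \<le> m" "k \<le> n"
  then show "kostant_q (real m *\<^sub>R \<alpha>1 + real n *\<^sub>R \<alpha>2 + real k *\<^sub>R \<alpha>3) =
    (\<Sum>i = m..m + n + k. monom (coeff_n_middle n k (int m + int n + int k - int i)) i)"
    by (intro kostant_q_eqI kostant_count_eq_0 coeff_n_middle) auto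
next
  assume "n \<le> k" "m \<le> n"
  then show "kostant_q (real m *\<^sub>R \<alpha>1 + real n *\<^sub>R \<alpha>2 + real k *\<^sub>R \<alpha>3) =
    (\<Sum>i = k..m + n + k. monom (coeff_n_middle n m (int m + int n + int k - int i)) i)"
    by (intro kostant_q_eqI; subst kostant_count_commute)
      (auto intro!: kostant_count_eq_0 coeff_n_middle)
next
  assume "m \<le> n" "k \<le> m"
  then show "kostant_q (real m *\<^sub>R \<alpha>1 + real n *\<^sub>R \<alpha>2 + real k *\<^sub>R \<alpha>3) =
    (\<Sum>i = n..m + n + k. monom (coeff_n_largest m n k (int m + int n + int k - int i)) i)"
    by (intro kostant_q_eqI kostant_count_eq_0 coeff_n_largest) auto
next
  assume "k \<le> n" "m \<le> k"
  then show "kostant_q (real m *\<^sub>R \<alpha>1 + real n *\<^sub>R \<alpha>2 + real k *\<^sub>R \<alpha>3) =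
    (\<Sum>i = n..m + n + k. monom (coeff_n_largest k n m (int m + int n + int k - int i)) i)"
    by (intro kostant_q_eqI; subst kostant_count_commute)
      (auto intro!: kostant_count_eq_0 coeff_n_largest)
qed

end
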